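(* Let $a,b\in\mathbb{R}$ with $0<a<b$, and let $n\in\mathbb{Z}$ with $|n|\geq1$ and $n\neq-1$. Then $$\left|A(a,b)^{n}-L_{n}(a,b)^{n}\right|\leq|n|\,\frac{b-a}{\sqrt6}\left[A\left(a^{2(n-1)},b^{2(n-1)}\right)\right]^{\frac12}.$$
   Context: For $a,b\ge 0$, the arithmetic mean is $A(a,b)=\frac{a+b}{2}$. For $r\in\mathbb{R}\setminus\{-1,0\}$ and $a,b>0$ with $a\neq b$, the $r$-logarithmic mean is $L_{r}(a,b)=\left[\frac{b^{r+1}-a^{r+1}}{(r+1)(b-a)}\right]^{1/r}$ (and $L_r(a,a)=a$). *)

theory Defs
  imports Complex_Main
begin

definition arith_mean :: "real \<Rightarrow> real \<Rightarrow> real" where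
  "arith_mean a b = (a + b) / 2"

(* Meant for a, b > 0 and r other than -1 and 0.  There, if a \<noteq> b, the base of the outer
   power is positive, so powr is the usual real power.  For r = -1 or r = 0 with a \<noteq> b
   the value is an artefact of division by zero. *)
definition log_mean :: "real \<Rightarrow> real \<Rightarrow> real \<Rightarrow> real" where
  "log_mean r a b =
     (if a = b then a
      else ((b powr (r + 1) - a powr (r + 1)) / ((r + 1) * (b - a))) powr (1 / r))"

end

(* L_n^n is the mean value of f(x) = x^n over [a,b].  Splitting [a,b] at its midpoint m, the
   mean value theorem writes it as (f(u) + f(v)) / 2 with a < u < m < v < b.  Since f is monotone,
   f(u) - f(m) and f(v) - f(m) have opposite signs, and each is at most M (b-a) / 2 in absolute
   value when |f'| <= M, so their sum is at most M (b-a) / 2.  One may take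
   M = |n| sqrt (a^(2(n-1)) + b^(2(n-1))), and sqrt 2 / 4 <= 1 / sqrt 6. *)
theory Submission
  imports Defs
begin

text \<open>Taking an antiderivative \<open>F\<close> in place of an integral leaves the mean value
  theorem as the only analytic tool. The sign condition on \<open>f'\<close> matters for the
  constant: it makes the two half-interval errors partly cancel.\<close>

lemma midpoint_minus_mean_value_le:
  fixes F f f' :: "real \<Rightarrow> real"
  assumes "a < b"
    and F: "\<And>x. a \<le> x \<Longrightarrow> x \<le> b \<Longrightarrow> (F has_real_derivative f x) (at x)"
    and f: "\<And>x. a \<le> x \<Longrightarrow> x \<le> b \<Longrightarrow> (f has_real_derivative f' x) (at x)"
    and nonneg: "\<And>x. a \<le> x \<Longrightarrow> x \<le> b \<Longrightarrow> 0 \<le> f' x"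
    and le: "\<And>x. a \<le> x \<Longrightarrow> x \<le> b \<Longrightarrow> f' x \<le> M"
  shows "\<bar>f ((a + b) / 2) - (F b - F a) / (b - a)\<bar> \<le> M * (b - a) / 4"
proof -
  define d where "d = M * (b - a)"
  define m where "m = (a + b) / 2"
  have am: "a < m" and mb: "m < b" using \<open>a < b\<close> by (auto simp: m_def)
  have incr: "0 \<le> f y - f x \<and> f y - f x \<le> d / 2"
    if "a \<le> x" "x < y" "y \<le> b" "y - x \<le> (b - a) / 2" for x y
  proof -
    have "\<exists>z>x. z < y \<and> f y - f x = (y - x) * f' z"
      by (rule MVT2) (use f that in auto)
    then obtain z where z: "x < z" "z < y" "f y - f x = (y - x) * f' z" by blast
    have "0 \<le> f' z" "f' z \<le> M" using nonneg le that z by auto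
    then have "(y - x) * f' z \<le> (b - a) / 2 * M" "0 \<le> (y - x) * f' z"
      using that \<open>a < b\<close> by (intro mult_mono mult_nonneg_nonneg; simp)+
    then show ?thesis using z by (simp add: d_def mult.commute)
  qed
  obtain u where u: "a < u" "u < m" "F m - F a = (m - a) * f u"
    using MVT2[OF am, of F f] F mb by fastforce
  obtain v where v: "m < v" "v < b" "F b - F m = (b - m) * f v"
    using MVT2[OF mb, of F f] F am by fastforce
  have "F b - F a = (b - a) * ((f u + f v) / 2)"
    using u(3) v(3) by (simp add: m_def field_simps)
  then have mean: "(F b - F a) / (b - a) = (f u + f v) / 2"
    using \<open>a < b\<close> by simp
  have "0 \<le> f m - f u \<and> f m - f u \<le> d / 2"
    by (rule incr) (use u mb in \<open>auto simp: m_def field_simps\<close>)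
  moreover have "0 \<le> f v - f m \<and> f v - f m \<le> d / 2"
    by (rule incr) (use v am in \<open>auto simp: m_def field_simps\<close>)
  \<comment> \<open>The deviation equals \<open>((f m - f u) - (f v - f m)) / 2\<close>. Both
    increments lie in the interval from 0 to \<open>d / 2\<close>, hence so does the absolute value
    of their difference, and halving gives \<open>d / 4\<close>.\<close>
  ultimately show ?thesis unfolding m_def[symmetric] d_def[symmetric] mean abs_le_iff
    by (simp add: field_simps)
qed

text \<open>The power is monotone in \<open>x\<close>, in a direction set by the sign of
  \<open>k\<close>, so one endpoint value dominates. Adding the other, nonnegative one gives a bound
  that is uniform in that sign.\<close>

lemma power_int_le_add_endpoints:
  fixes a b x :: real
  assumes "0 < a" "a \<le> x" "x \<le> b"
  shows "x powi k \<le> a powi k + b powi k"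
proof (cases "0 \<le> k")
  case True
  then have "x powi k \<le> b powi k" using assms by (intro power_int_mono) auto
  moreover have "0 \<le> a powi k" using assms by simp
  ultimately show ?thesis by linarith
next
  case False
  then have "x powi k \<le> a powi k" using assms by (intro power_int_antimono) auto
  moreover have "0 \<le> b powi k" using assms by simp
  ultimately show ?thesis by linarith
qed

text \<open>The base \<open>q\<close> of the outer power is positive, since numerator and
  denominator change sign together with \<open>n + 1\<close>; hence the exponents
  \<open>1 / n\<close> and \<open>n\<close> cancel. The result is the mean value of the
  \<open>n\<close>-th power over the interval.\<close>

lemma log_mean_powi:
  fixes a b :: real and n :: int
  assumes "0 < a" "a < b" "n \<noteq> 0" "n \<noteq> -1"
  shows "log_mean (real_of_int n) a b powi n
           = (b powi (n + 1) - a powi (n + 1)) / (real_of_int (n + 1) * (b - a))"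
proof -
  define q where "q = (b powi (n + 1) - a powi (n + 1)) / (real_of_int (n + 1) * (b - a))"
  have "0 < q"
  proof (cases "0 < n + 1")
    case True
    then have "a powi (n + 1) < b powi (n + 1)"
      using assms by (intro power_int_strict_mono) auto
    with True show ?thesis using assms by (auto simp: q_def)
  next
    case False
    then have "n + 1 < 0" using assms by simp
    then have "b powi (n + 1) < a powi (n + 1)"
      using assms by (intro power_int_strict_antimono) auto
    moreover have "real_of_int (n + 1) * (b - a) < 0"
      using \<open>n + 1 < 0\<close> assms by (intro mult_neg_pos) linarith+
    ultimately show ?thesis unfolding q_def by (intro divide_neg_neg) auto
  qed
  have powr: "x powr (real_of_int n + 1) = x powi (n + 1)" if "0 < x" for x :: real
    using powr_real_of_int'[of x "n + 1"] that by simp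
  have "log_mean (real_of_int n) a b = q powr (1 / real_of_int n)"
    using assms by (simp add: log_mean_def q_def powr)
  also have "\<dots> powi n = q powr (1 / real_of_int n * real_of_int n)"
    using \<open>0 < q\<close> by (simp add: powr_powr flip: powr_real_of_int')
  also have "\<dots> = q" using \<open>0 < q\<close> assms by simp
  finally show ?thesis by (simp add: q_def)
qed

theorem proposition1:
  fixes a b :: real and n :: int
  assumes "0 < a" and "a < b" and "\<bar>n\<bar> \<ge> 1" and "n \<noteq> -1"
  shows "\<bar>arith_mean a b powi n - log_mean (real_of_int n) a b powi n\<bar>
           \<le> real_of_int \<bar>n\<bar> * ((b - a) / sqrt 6)
              * arith_mean (a powi (2 * (n - 1))) (b powi (2 * (n - 1))) powr (1 / 2)"
proof -
  define S where "S = arith_mean (a powi (2 * (n - 1))) (b powi (2 * (n - 1)))"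
  define M where "M = real_of_int \<bar>n\<bar> * sqrt (2 * S)"
  \<comment> \<open>The sign satisfies \<open>s * n = \<bar>n\<bar>\<close>, so \<open>f\<close> is
    increasing even for negative \<open>n\<close>; it disappears again under the absolute
    value.\<close>
  define s where "s = (if 0 < n then 1 else -1 :: real)"
  define F where "F = (\<lambda>x::real. s * (x powi (n + 1) / real_of_int (n + 1)))"
  define f where "f = (\<lambda>x::real. s * x powi n)"
  define f' where "f' = (\<lambda>x::real. real_of_int \<bar>n\<bar> * x powi (n - 1))"
  have "n \<noteq> 0" using assms by auto
  have n1: "real_of_int n + 1 \<noteq> 0" using assms by linarith
  have "0 \<le> S" using assms by (simp add: S_def arith_mean_def)
  have "\<bar>f ((a + b) / 2) - (F b - F a) / (b - a)\<bar> \<le> M * (b - a) / 4"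
  proof (rule midpoint_minus_mean_value_le)
    fix x assume x: "a \<le> x" "x \<le> b"
    then have "0 < x" using assms by simp
    show "(F has_real_derivative f x) (at x)"
    proof -
      have "((\<lambda>x. x powi (n + 1)) has_real_derivative real_of_int (n + 1) * x powi n) (at x)"
        using \<open>0 < x\<close> by (auto intro!: derivative_eq_intros)
      from DERIV_cmult[OF DERIV_cdivide[OF this, of "real_of_int (n + 1)"], of s]
      show ?thesis using n1 by (simp add: F_def f_def)
    qed
    show "(f has_real_derivative f' x) (at x)"
      unfolding f_def f'_def s_def using \<open>0 < x\<close> \<open>n \<noteq> 0\<close>
      by (auto intro!: derivative_eq_intros)
    show "0 \<le> f' x" using \<open>0 < x\<close> by (simp add: f'_def)
    \<comment> \<open>Squaring brings in the exponent that occurs in \<open>S\<close>, and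
      \<open>2 * S\<close> is exactly the sum of the endpoint powers.\<close>
    have "(x powi (n - 1))\<^sup>2 = x powi (2 * (n - 1))"
      by (metis power_int_mult power_int_numeral mult.commute)
    also have "\<dots> \<le> 2 * S"
      using power_int_le_add_endpoints[of a x b "2 * (n - 1)"] x assms by (simp add: S_def arith_mean_def)
    finally have "x powi (n - 1) \<le> sqrt (2 * S)" by (rule real_le_rsqrt)
    then show "f' x \<le> M" unfolding f'_def M_def by (intro mult_left_mono) auto
  qed (use assms in auto)
  also have "f ((a + b) / 2) - (F b - F a) / (b - a)
      = s * (arith_mean a b powi n - log_mean (real_of_int n) a b powi n)"
    unfolding log_mean_powi[OF assms(1,2) \<open>n \<noteq> 0\<close> assms(4)]
    using n1 assms by (simp add: f_def F_def arith_mean_def divide_simps) (simp add: algebra_simps)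
  finally have *: "\<bar>arith_mean a b powi n - log_mean (real_of_int n) a b powi n\<bar> \<le> M * (b - a) / 4"
    by (simp add: s_def abs_mult split: if_splits)
  \<comment> \<open>The factor \<open>sqrt 2\<close> comes from \<open>M\<close> and the 4 from the
    midpoint estimate; the claim is that 12 is at most 16.\<close>
  have "sqrt 2 * sqrt 6 \<le> 4"
    unfolding real_sqrt_mult[symmetric] by (rule real_le_lsqrt) auto
  then have "sqrt 2 / 4 \<le> 1 / sqrt 6" by (simp add: field_simps)
  then have "sqrt 2 / 4 * (real_of_int \<bar>n\<bar> * (b - a) * sqrt S)
      \<le> 1 / sqrt 6 * (real_of_int \<bar>n\<bar> * (b - a) * sqrt S)"
    using assms \<open>0 \<le> S\<close> by (intro mult_right_mono) auto
  then have "M * (b - a) / 4 \<le> real_of_int \<bar>n\<bar> * ((b - a) / sqrt 6) * sqrt S"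
    by (simp add: M_def real_sqrt_mult mult_ac)
  with * show ?thesis
    unfolding S_def[symmetric] powr_half_sqrt[OF \<open>0 \<le> S\<close>] by (rule order_trans)
qed

end
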